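(* Let $\lambda,\xi>0$, let $B=\{B(t),t\ge 0\}$ be the linear birth (Yule) process of rate $\lambda$ with $B(0)=1$, and let $X_j$, $j=1,2,\dots$, be i.i.d. $\mathrm{Exp}(\xi)$ random variables, independent of $B$. Then the density of $$Y(t)=\sum_{j=1}^{B(t)}X_j,\qquad t\ge 0,$$ namely $$f_Y(y,t)=\xi\exp\left\{-\lambda t-\xi e^{-\lambda t}y\right\},\qquad y,t\ge 0,$$ satisfies the equation $$\frac{\partial}{\partial t}f=-\lambda\frac{\partial}{\partial y}\left(yf\right),\qquad y,t\ge 0,$$ with $f(y,0)=f_X(y)=\xi e^{-\xi y}$.
   Context: The linear birth process $B$ is the continuous-time Markov process on $\{1,2,\dots\}$ with $B(0)=1$ which jumps from $k$ to $k+1$ at rate $k\lambda$; its one-dimensional law is $P\{B(t)=n\}=e^{-\lambda t}(1-e^{-\lambda t})^{n-1}$, $n=1,2,\dots$, $t\ge 0$. $\mathrm{Exp}(\xi)$ denotes the exponential law with density $f_X(x)=\xi e^{-\xi x}$, $x\ge 0$. *)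

theory Defs
  imports "HOL-Probability.Probability"
begin

definition transition_function :: "nat set \<Rightarrow> (real \<Rightarrow> nat \<Rightarrow> nat \<Rightarrow> real) \<Rightarrow> bool" where
  "transition_function S p \<longleftrightarrow>
     (\<forall>t\<ge>0. \<forall>i\<in>S. (\<forall>j\<in>S. 0 \<le> p t i j) \<and> (p t i has_sum 1) S) \<and>
     (\<forall>i\<in>S. \<forall>j\<in>S. p 0 i j = (if i = j then 1 else 0)) \<and>
     (\<forall>s\<ge>0. \<forall>t\<ge>0. \<forall>i\<in>S. \<forall>j\<in>S. ((\<lambda>k. p s i k * p t k j) has_sum p (s + t) i j) S)"

text \<open>Time-homogeneous Markov process in continuous time on the countable state space S: given the
  states at finitely many times, the law of a later state is that of the transition function from
  the latest of them. The guard is needed because the conditional probability given a null event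
  is 0 by convention.\<close>

definition markov_chain ::
  "'a measure \<Rightarrow> nat set \<Rightarrow> (real \<Rightarrow> nat \<Rightarrow> nat \<Rightarrow> real) \<Rightarrow> (real \<Rightarrow> 'a \<Rightarrow> nat) \<Rightarrow> bool" where
  "markov_chain M S p B \<longleftrightarrow>
     transition_function S p \<and>
     (\<forall>t\<ge>0. B t \<in> measurable M (count_space S)) \<and>
     (\<forall>n (ts :: nat \<Rightarrow> real) (ks :: nat \<Rightarrow> nat) u. \<forall>j\<in>S.
        0 \<le> ts 0 \<and> (\<forall>i<n. ts i < ts (Suc i)) \<and> ts n < u \<and>
        \<P>(\<omega> in M. \<forall>i\<le>n. B (ts i) \<omega> = ks i) \<noteq> 0 \<longrightarrow>
        \<P>(\<omega> in M. B u \<omega> = j \<bar> \<forall>i\<le>n. B (ts i) \<omega> = ks i) = p (u - ts n) (ks n) j)"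

text \<open>A right-continuous path with left limits in the discrete space of naturals whose only jumps
  lead from k to k + 1.\<close>

definition birth_path :: "(real \<Rightarrow> nat) \<Rightarrow> bool" where
  "birth_path b \<longleftrightarrow>
     (\<forall>t\<ge>0. \<forall>\<^sub>F s in at_right t. b s = b t) \<and>
     (\<forall>t>0. \<exists>k. (\<forall>\<^sub>F s in at_left t. b s = k) \<and> (b t = k \<or> b t = Suc k))"

text \<open>Jumping from k to k + 1 at rate k * l, and to no other state, means that for small h > 0
  the transition probability from k to k + 1 is k * l * h + o(h) and that from k to k is
  1 - k * l * h + o(h).\<close>

definition linear_birth_process :: "'a measure \<Rightarrow> real \<Rightarrow> (real \<Rightarrow> 'a \<Rightarrow> nat) \<Rightarrow> bool" where
  "linear_birth_process M l B \<longleftrightarrow>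
     (\<exists>p. markov_chain M {1..} p B \<and>
        (\<forall>k\<ge>1. ((\<lambda>h. p h k (Suc k) / h) \<longlongrightarrow> real k * l) (at_right 0) \<and>
                ((\<lambda>h. (1 - p h k k) / h) \<longlongrightarrow> real k * l) (at_right 0))) \<and>
     (AE \<omega> in M. B 0 \<omega> = 1) \<and>
     (AE \<omega> in M. birth_path (\<lambda>t. B t \<omega>))"

text \<open>The library's indep_var, for two random elements whose values have different types.\<close>

definition indep_elements ::
  "'a measure \<Rightarrow> 'b measure \<Rightarrow> ('a \<Rightarrow> 'b) \<Rightarrow> 'c measure \<Rightarrow> ('a \<Rightarrow> 'c) \<Rightarrow> bool" where
  "indep_elements M N U N' V \<longleftrightarrow>
     U \<in> measurable M N \<and> V \<in> measurable M N' \<and>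
     prob_space.indep_set M {U -` A \<inter> space M | A. A \<in> sets N} {V -` A \<inter> space M | A. A \<in> sets N'}"

definition f_Y :: "real \<Rightarrow> real \<Rightarrow> real \<Rightarrow> real \<Rightarrow> real" where
  "f_Y l \<xi> y t = \<xi> * exp (- l * t - \<xi> * exp (- l * t) * y)"

end

theory Submission
  imports Defs
begin

text \<open>Because the rate of jumps from \<open>i\<close> to \<open>i + 1\<close> exhausts the exit rate of \<open>i\<close>, the transition
  function satisfies the backward equation \<open>p'(t, i, j) = i l (p(t, i + 1, j) - p(t, i, j))\<close>. A maximum
  principle shows that a bounded solution of this equation is determined by its initial values, so
  the transition function is the negative binomial one and \<open>B t\<close> is geometric with parameter
  \<open>x = exp (- l * t)\<close>. Given \<open>B t = n\<close>, the sum is Erlang distributed; mixing the Erlang densities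
  with the geometric weights leaves an exponential series, whose sum is the exponential density of
  rate \<open>\<xi> x\<close>.\<close>

section \<open>General transition functions: first-step estimate, continuity, backward
  equation\<close>

lemma transition_function_bounds:
  assumes "transition_function S p" "t \<ge> 0" "i \<in> S" "j \<in> S"
  shows "0 \<le> p t i j" and "p t i j \<le> 1"
proof -
  show "0 \<le> p t i j"
    using assms by (auto simp: transition_function_def)
  show "p t i j \<le> 1"
    using assms finite_sum_le_has_sum[where f = "p t i" and B = "{j}" and A = S] by (auto simp: transition_function_def)
qed

text \<open>Chapman-Kolmogorov at the early time \<open>h\<close>: the states other than
  \<open>i\<close> and \<open>k\<close> contribute a nonnegative sum, at most the mass that
  \<open>p h i\<close> gives them because \<open>p s m j\<close> never exceeds 1. For a birth
  process with \<open>k = Suc i\<close> this mass is o(h).\<close>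

lemma transition_function_first_step:
  assumes p: "transition_function S p" and S: "i \<in> S" "k \<in> S" "j \<in> S" "i \<noteq> k"
    and "s \<ge> 0" "h \<ge> 0"
  shows "\<bar>p (s + h) i j - p h i i * p s i j - p h i k * p s k j\<bar> \<le> 1 - p h i i - p h i k"
proof -
  let ?T = "S - {i, k}"
  note bounds = transition_function_bounds[OF p]
  have "((\<lambda>m. p h i m * p s m j) has_sum p (h + s) i j) S"
    using assms by (auto simp: transition_function_def)
  then have 1: "((\<lambda>m. p h i m * p s m j) has_sum
      p (s + h) i j - (p h i i * p s i j + p h i k * p s k j)) ?T"
    using has_sum_Diff[OF _ has_sum_finite[of "{i, k}"], where B = S] S
    by (simp add: add.commute)
  have "(p h i has_sum 1) S"
    using assms by (auto simp: transition_function_def)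
  then have 2: "(p h i has_sum 1 - (p h i i + p h i k)) ?T"
    using has_sum_Diff[OF _ has_sum_finite[of "{i, k}"], where B = S] S by simp
  have "0 \<le> p (s + h) i j - (p h i i * p s i j + p h i k * p s k j)"
    by (rule has_sum_nonneg[OF 1]) (use assms bounds in auto)
  moreover have "p (s + h) i j - (p h i i * p s i j + p h i k * p s k j) \<le> 1 - (p h i i + p h i k)"
    by (rule has_sum_mono[OF 1 2]) (use assms bounds in \<open>auto intro!: mult_left_le\<close>)
  ultimately show ?thesis
    by (simp add: algebra_simps)
qed

text \<open>The bound does not involve \<open>s\<close>, so it acts as a uniform modulus of
  continuity in time.\<close>

lemma transition_function_increment:
  assumes p: "transition_function S p" and S: "i \<in> S" "k \<in> S" "j \<in> S" "i \<noteq> k"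
    and st: "s \<ge> 0" "h \<ge> 0"
  shows "\<bar>p (s + h) i j - p s i j\<bar> \<le> 2 * (1 - p h i i)"
proof -
  note bounds = transition_function_bounds[OF p]
  have "0 \<le> p h i k * p s k j" "p h i k * p s k j \<le> p h i k"
    using bounds assms by (auto intro!: mult_left_le)
  moreover have "0 \<le> (1 - p h i i) * p s i j" "(1 - p h i i) * p s i j \<le> 1 - p h i i"
    using bounds assms by (auto intro!: mult_left_le)
  ultimately show ?thesis
    using transition_function_first_step[OF assms] by (auto simp: algebra_simps abs_le_iff)
qed

lemma transition_function_continuous:
  assumes p: "transition_function S p" and S: "i \<in> S" "k \<in> S" "j \<in> S" "i \<noteq> k"
    and lim: "((\<lambda>h. p h i i) \<longlongrightarrow> 1) (at_right 0)"
  shows "continuous_on {0..} (\<lambda>t. p t i j)"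
  unfolding continuous_on_iff
proof (intro ballI allI impI)
  fix t e :: real assume t: "t \<in> {0..}" and "e > 0"
  \<comment> \<open>Half of \<open>e\<close> compensates the factor 2 in the increment
    bound.\<close>
  then have "\<forall>\<^sub>F h in at_right 0. dist (p h i i) 1 < e / 2"
    using lim by (intro tendstoD) auto
  then obtain d where d: "d > 0" "\<And>h. 0 < h \<Longrightarrow> h < d \<Longrightarrow> dist (p h i i) 1 < e / 2"
    unfolding eventually_at_right_field by auto
  \<comment> \<open>Stated from an earlier to a later time; exchanging the two gives continuity from
    both sides.\<close>
  have close: "\<bar>p u i j - p v i j\<bar> < e" if "0 \<le> v" "v \<le> u" "u - v < d" for u v
  proof (cases "u = v")
    case False
    then have "\<bar>p (v + (u - v)) i j - p v i j\<bar> \<le> 2 * (1 - p (u - v) i i)"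
      using that by (intro transition_function_increment[OF p S]) auto
    then show ?thesis
      using d(2)[of "u - v"] that False by (auto simp: dist_real_def abs_less_iff)
  qed (use \<open>e > 0\<close> in auto)
  show "\<exists>d>0. \<forall>x'\<in>{0..}. dist x' t < d \<longrightarrow> dist (p x' i j) (p t i j) < e"
  proof (intro exI conjI ballI impI)
    fix u :: real assume "u \<in> {0..}" "dist u t < d"
    then show "dist (p u i j) (p t i j) < e"
      using close[of t u] close[of u t] t by (cases "t \<le> u") (auto simp: dist_real_def abs_if split: if_splits)
  qed (rule d)
qed

text \<open>The left derivative suffices for the maximum principle below, which only looks back in time.\<close>

lemma transition_function_backward_left:
  assumes p: "transition_function S p" and S: "i \<in> S" "k \<in> S" "j \<in> S" "i \<noteq> k"
    and out: "((\<lambda>h. (1 - p h i i) / h) \<longlongrightarrow> q) (at_right 0)"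
    and jump: "((\<lambda>h. p h i k / h) \<longlongrightarrow> q) (at_right 0)"
    and cont: "continuous_on {0..} (\<lambda>t. p t i j)" "continuous_on {0..} (\<lambda>t. p t k j)"
    and "t > 0"
  shows "((\<lambda>t. p t i j) has_real_derivative q * (p t k j - p t i j)) (at_left t)"
proof -
  have shift: "((\<lambda>h. p (t - h) m j) \<longlongrightarrow> p t m j) (at_right 0)"
    if "continuous_on {0..} (\<lambda>t. p t m j)" for m
  proof -
    have "isCont (\<lambda>t. p t m j) t"
      using continuous_on_subset[OF that, of "{0<..}"] \<open>t > 0\<close>
      by (simp add: continuous_on_eq_continuous_at subset_eq)
    moreover have "((\<lambda>h. t - h) \<longlongrightarrow> t) (at_right 0)"
      by (auto intro!: tendsto_eq_intros)
    ultimately show ?thesis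
      by (rule isCont_tendsto_compose)
  qed
  \<comment> \<open>The contribution to \<open>p t i j\<close> of paths that at time
    \<open>h\<close> are neither in \<open>i\<close> nor in \<open>k\<close>. It is o(h) because the
    exit rate and the rate towards \<open>k\<close> are the same \<open>q\<close> and
    cancel.\<close>
  define R where "R h = p t i j - p h i i * p (t - h) i j - p h i k * p (t - h) k j" for h
  have ev: "\<forall>\<^sub>F h in at_right 0. 0 < h \<and> h < t"
    using \<open>t > 0\<close> eventually_at_right_real by fastforce
  have "((\<lambda>h. R h / h) \<longlongrightarrow> 0) (at_right 0)"
  proof (rule Lim_null_comparison)
    show "((\<lambda>h. (1 - p h i i) / h - p h i k / h) \<longlongrightarrow> 0) (at_right 0)"
      using tendsto_diff[OF out jump] by simp
    show "\<forall>\<^sub>F h in at_right 0. norm (R h / h) \<le> (1 - p h i i) / h - p h i k / h"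
      using ev
    proof eventually_elim
      case (elim h)
      then show ?case
        using transition_function_first_step[OF p S, of "t - h" h]
        by (simp add: R_def abs_divide flip: diff_divide_distrib) (intro divide_right_mono, auto)
    qed
  qed
  then have "((\<lambda>h. R h / h - (1 - p h i i) / h * p (t - h) i j + p h i k / h * p (t - h) k j)
      \<longlongrightarrow> 0 - q * p t i j + q * p t k j) (at_right 0)"
    by (intro tendsto_intros out jump shift cont)
  moreover have "\<forall>\<^sub>F h in at_right 0. R h / h - (1 - p h i i) / h * p (t - h) i j
      + p h i k / h * p (t - h) k j = (p (t - h) i j - p t i j) / (- h)"
    using ev by eventually_elim (auto simp: R_def divide_simps algebra_simps)
  ultimately have "((\<lambda>h. (p (t - h) i j - p t i j) / (- h)) \<longlongrightarrow> q * (p t k j - p t i j)) (at_right 0)"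
    by (subst (asm) tendsto_cong) (auto simp: algebra_simps)
  \<comment> \<open>The limit over positive \<open>h\<close> of the backward quotient is the left
    derivative, after reflecting and shifting the filter.\<close>
  then show ?thesis
    by (simp add: has_field_derivative_iff filterlim_at_left_to_right
        filterlim_at_right_to_0[of _ _ "- t"])
qed

section \<open>Uniqueness for the backward equation of the birth process\<close>

text \<open>The exact solution \<open>i * exp (l * t)\<close> of the backward equation is unbounded in \<open>i\<close>, so
  subtracting a small multiple of it confines positive values to finitely many states, where a maximum
  exists; doubling its exponent makes the inequality at that maximum strict.\<close>

lemma birth_backward_maximum_principle:
  fixes v :: "nat \<Rightarrow> real \<Rightarrow> real"
  assumes "l > 0"
    and cont: "\<And>i. i \<ge> 1 \<Longrightarrow> continuous_on {0..} (v i)"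
    and init: "\<And>i. i \<ge> 1 \<Longrightarrow> v i 0 \<le> 0"
    and bound: "\<And>i t. i \<ge> 1 \<Longrightarrow> t \<ge> 0 \<Longrightarrow> v i t \<le> C"
    and deriv: "\<And>i t. i \<ge> 1 \<Longrightarrow> t > 0 \<Longrightarrow>
      (v i has_real_derivative (real i * l) * (v (Suc i) t - v i t)) (at_left t)"
    and "i \<ge> 1" "t \<ge> 0"
  shows "v i t \<le> 0"
proof (rule ccontr)
  assume "\<not> v i t \<le> 0"
  \<comment> \<open>Chosen so that the penalty at state \<open>i\<close> and time \<open>t\<close>
    is half of \<open>v i t\<close>, which leaves \<open>w i t\<close> positive.\<close>
  define \<epsilon> where "\<epsilon> = v i t / (2 * real i * exp (2 * l * t))"
  define w where "w k s = v k s - \<epsilon> * (real k * exp (2 * l * s))" for k s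
  have \<epsilon>: "\<epsilon> > 0" and w_pos: "w i t > 0"
    using \<open>\<not> v i t \<le> 0\<close> \<open>i \<ge> 1\<close> by (auto simp: \<epsilon>_def w_def field_simps)
  obtain N0 :: nat where N0: "real N0 > C / \<epsilon>"
    using reals_Archimedean2 by blast
  define N where "N = max i N0"
  \<comment> \<open>From \<open>N\<close> on, the penalty is at least the uniform bound
    \<open>C\<close>, so a positive maximum can only sit in \<open>{1..N}\<close>.\<close>
  have large: "w k s \<le> 0" if "k \<ge> N" "s \<ge> 0" for k s
  proof -
    have "1 * real k \<le> exp (2 * l * s) * real k"
      using that \<open>l > 0\<close> by (intro mult_right_mono) auto
    moreover have "real N0 \<le> real k"
      using that by (auto simp: N_def)
    ultimately have "C / \<epsilon> \<le> real k * exp (2 * l * s)"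
      using N0 by (simp add: mult.commute)
    then have "C \<le> \<epsilon> * (real k * exp (2 * l * s))"
      using \<epsilon> by (simp add: field_simps)
    then show ?thesis
      using bound[of k s] that \<open>i \<ge> 1\<close> by (auto simp: w_def N_def)
  qed
  have "\<exists>s\<in>{0..t}. \<forall>u\<in>{0..t}. w k u \<le> w k s" if "k \<ge> 1" for k
    unfolding w_def using \<open>t \<ge> 0\<close> that
    by (intro continuous_attains_sup continuous_intros continuous_on_subset[OF cont]) auto
  then obtain s where s: "\<And>k. k \<ge> 1 \<Longrightarrow> s k \<in> {0..t}"
      and s_max: "\<And>k u. k \<ge> 1 \<Longrightarrow> u \<in> {0..t} \<Longrightarrow> w k u \<le> w k (s k)"
    by metis
  let ?W = "(\<lambda>k. w k (s k)) ` {1..N}"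
  have "Max ?W \<in> ?W"
    using \<open>i \<ge> 1\<close> by (intro Max_in) (auto simp: N_def)
  then obtain m where m: "m \<in> {1..N}" and Max: "Max ?W = w m (s m)"
    by auto
  have m_max: "w k u \<le> w m (s m)" if "k \<in> {1..N}" "u \<in> {0..t}" for k u
  proof -
    have "w k u \<le> w k (s k)"
      using that by (intro s_max) auto
    also have "\<dots> \<le> Max ?W"
      using that by (intro Max_ge) auto
    finally show ?thesis
      by (simp only: Max)
  qed
  have m_pos: "w m (s m) > 0"
    using w_pos m_max[of i t] \<open>i \<ge> 1\<close> \<open>t \<ge> 0\<close> by (auto simp: N_def)
  have "w m 0 \<le> 0"
    using init[of m] m \<epsilon> by (simp add: w_def) (smt (verit) mult_nonneg_nonneg of_nat_0_le_iff)
  then have s_pos: "s m > 0"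
    using s[of m] m m_pos by (cases "s m = 0") auto
  \<comment> \<open>If \<open>Suc m\<close> lies beyond \<open>N\<close>, its value is at most 0 and
    hence below the positive maximum.\<close>
  have step: "w (Suc m) (s m) \<le> w m (s m)"
    using large[of "Suc m" "s m"] m_max[of "Suc m" "s m"] m_pos s[of m] m
    by (cases "Suc m \<le> N") auto
  let ?D = "(real m * l) * (v (Suc m) (s m) - v m (s m)) - \<epsilon> * (real m * (exp (2 * l * s m) * (2 * l)))"
  have "(w m has_real_derivative ?D) (at_left (s m))"
    unfolding w_def[abs_def] by (rule derivative_eq_intros deriv refl | use m s_pos in simp)+
  moreover have "?D < 0"
  proof -
    \<comment> \<open>Rewriting the increment of \<open>v\<close> through \<open>w\<close> adds one
      copy of the penalty term, while the doubled exponent subtracts two; one copy remains with a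
      negative sign.\<close>
    have "?D = (real m * l) * (w (Suc m) (s m) - w m (s m)) - \<epsilon> * real m * l * exp (2 * l * s m)"
      by (simp add: w_def algebra_simps)
    moreover have "(real m * l) * (w (Suc m) (s m) - w m (s m)) \<le> 0"
      using step \<open>l > 0\<close> by (auto intro!: mult_nonneg_nonpos)
    moreover have "\<epsilon> * real m * l * exp (2 * l * s m) > 0"
      using \<epsilon> \<open>l > 0\<close> m by auto
    ultimately show ?thesis
      by linarith
  qed
  ultimately obtain d where d: "d > 0" "\<And>h. h > 0 \<Longrightarrow> h < d \<Longrightarrow> w m (s m) < w m (s m - h)"
    using has_real_derivative_neg_dec_left[of "w m" ?D "s m" "{..<s m}"] by force
  \<comment> \<open>Small enough for the strict decrease, and at most \<open>s m\<close> so that the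
    earlier time stays in the interval over which the maximum is taken.\<close>
  define h where "h = min (d / 2) (s m)"
  have "w m (s m) < w m (s m - h)"
    using d s_pos by (intro d) (auto simp: h_def)
  moreover have "w m (s m - h) \<le> w m (s m)"
    using m s[of m] s_pos d by (intro m_max) (auto simp: h_def)
  ultimately show False
    by simp
qed

section \<open>The negative binomial transition function\<close>

text \<open>For \<open>i > j\<close> the binomial coefficient vanishes, so the truncated exponent is harmless.\<close>

definition yule_transition :: "real \<Rightarrow> real \<Rightarrow> nat \<Rightarrow> nat \<Rightarrow> real" where
  "yule_transition l t i j =
     real ((j - 1) choose (i - 1)) * exp (- l * t) ^ i * (1 - exp (- l * t)) ^ (j - i)"

lemma yule_transition_0: "i \<ge> 1 \<Longrightarrow> j \<ge> 1 \<Longrightarrow> yule_transition l 0 i j = (if i = j then 1 else 0)"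
  by (cases i j rule: linorder_cases) (auto simp: yule_transition_def)

lemma yule_transition_backward:
  assumes "i \<ge> 1" "j \<ge> 1"
  shows "((\<lambda>t. yule_transition l t i j) has_real_derivative
    (real i * l) * (yule_transition l t (Suc i) j - yule_transition l t i j)) (at t within A)"
proof -
  obtain a b where ij: "i = Suc a" "j = Suc b"
    using assms by (metis Suc_le_D One_nat_def)
  define x where "x = exp (- l * t)"
  have dx: "((\<lambda>t. exp (- l * t)) has_real_derivative - l * x) (at t within A)"
    by (auto simp: x_def intro!: derivative_eq_intros)
  note dpow = DERIV_power_Suc[OF dx]
  \<comment> \<open>For \<open>b < a\<close> all terms vanish, and for \<open>b = a\<close> the term
    of the next state does. Writing the gap as \<open>Suc c\<close> turns the truncated exponents
    into \<open>Suc c\<close> and \<open>c\<close>.\<close>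
  consider "b < a" | "b = a" | c where "b = a + Suc c"
    using less_iff_Suc_add by (metis add_Suc_right nat_neq_iff)
  then show ?thesis
  proof cases
    case 1
    then show ?thesis
      by (simp add: yule_transition_def ij binomial_eq_0)
  next
    case 2
    show ?thesis
      unfolding yule_transition_def ij 2 diff_self_eq_0 power_0
      by (rule DERIV_cong[OF DERIV_mult[OF DERIV_mult[OF DERIV_const dpow] DERIV_const]])
        (simp add: x_def binomial_eq_0 algebra_simps)
  next
    case (3 c)
    \<comment> \<open>This absorption identity matches the term of the next state with the
      derivative of the power of \<open>1 - x\<close>.\<close>
    have "Suc a * (b choose Suc a) = (b - a) * (b choose a)"
      by (cases b) (use 3 binomial_absorb_comp[of b a] binomial_absorption[of a b] in \<open>simp_all add: mult.commute\<close>)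
    then have absorb: "real (Suc a) * real (b choose Suc a) = real (Suc c) * real (b choose a)"
      unfolding of_nat_mult[symmetric] using 3 by simp
    have exponents: "Suc b - Suc a = Suc c" "Suc b - Suc (Suc a) = c"
      using 3 by auto
    have "real i * l * (yule_transition l t (Suc i) j - yule_transition l t i j)
        = l * x ^ Suc (Suc a) * (1 - x) ^ c * (real (Suc a) * real (b choose Suc a))
          - real (Suc a) * l * (real (b choose a) * x ^ Suc a * (1 - x) ^ Suc c)"
      unfolding yule_transition_def ij exponents by (simp add: x_def algebra_simps)
    also have "\<dots> = real (b choose a) * (- l * real (Suc a) * x ^ Suc a * (1 - x) ^ Suc c
         + l * real (Suc c) * x ^ Suc (Suc a) * (1 - x) ^ c)"
      unfolding absorb by (simp add: algebra_simps)
    finally show ?thesis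
      unfolding yule_transition_def ij diff_Suc_1 exponents
      by (intro DERIV_cong[OF DERIV_mult[OF DERIV_mult[OF DERIV_const dpow]
            DERIV_power_Suc[OF DERIV_diff[OF DERIV_const dx]]]])
        (simp add: x_def algebra_simps)
  qed
qed

text \<open>Supplies a bound independent of the starting state \<open>i\<close> and of time, as the
  maximum principle requires.\<close>

lemma yule_transition_bounded:
  assumes "l > 0" "t \<ge> 0"
  shows "\<bar>yule_transition l t i j\<bar> \<le> 2 ^ (j - 1)"
proof -
  have "real ((j - 1) choose (i - 1)) \<le> 2 ^ (j - 1)"
    using binomial_le_pow2[of "j - 1" "i - 1"] by (metis of_nat_le_iff of_nat_numeral of_nat_power)
  moreover have "0 \<le> exp (- l * t) ^ i" "exp (- l * t) ^ i \<le> 1"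
    "0 \<le> (1 - exp (- l * t)) ^ (j - i)" "(1 - exp (- l * t)) ^ (j - i) \<le> 1"
    using assms by (auto intro!: power_le_one zero_le_power)
  ultimately have "yule_transition l t i j \<le> 2 ^ (j - 1) * 1 * 1"
    unfolding yule_transition_def by (intro mult_mono) auto
  moreover have "0 \<le> yule_transition l t i j"
    unfolding yule_transition_def using assms by (intro mult_nonneg_nonneg zero_le_power) auto
  ultimately show ?thesis
    by simp
qed

text \<open>For fixed \<open>j\<close>, both sides solve the same linear backward equation with the
  same initial values. The maximum principle is applied to their difference with either
  sign.\<close>

lemma linear_birth_transition:
  assumes p: "transition_function {1..} p" and "l > 0"
    and jump: "\<And>k. k \<ge> 1 \<Longrightarrow> ((\<lambda>h. p h k (Suc k) / h) \<longlongrightarrow> real k * l) (at_right 0)"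
    and out: "\<And>k. k \<ge> 1 \<Longrightarrow> ((\<lambda>h. (1 - p h k k) / h) \<longlongrightarrow> real k * l) (at_right 0)"
    and "i \<ge> 1" "j \<ge> 1" "t \<ge> 0"
  shows "p t i j = yule_transition l t i j"
proof -
  \<comment> \<open>A finite exit rate forces \<open>1 - p h k k\<close> to vanish with
    \<open>h\<close>, which yields continuity in time.\<close>
  have lim: "((\<lambda>h. p h k k) \<longlongrightarrow> 1) (at_right 0)" if "k \<ge> 1" for k
  proof -
    have "((\<lambda>h. 1 - (1 - p h k k) / h * h) \<longlongrightarrow> 1 - (real k * l) * 0) (at_right 0)"
      by (intro tendsto_intros out that)
    moreover have "\<forall>\<^sub>F h in at_right 0. 1 - (1 - p h k k) / h * h = p h k k"
      using eventually_at_right_less[of 0] by eventually_elim auto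
    ultimately show ?thesis
      by (subst (asm) tendsto_cong) auto
  qed
  have cont_p: "continuous_on {0..} (\<lambda>t. p t k j)" if "k \<ge> 1" for k
    using that \<open>j \<ge> 1\<close> by (intro transition_function_continuous[OF p, where k = "Suc k"] lim) auto
  have cont_y: "continuous_on {0..} (\<lambda>t. yule_transition l t k j)" for k
    unfolding yule_transition_def by (intro continuous_intros)
  have deriv_p: "((\<lambda>t. p t k j) has_real_derivative (real k * l) * (p t (Suc k) j - p t k j)) (at_left t)"
    if "k \<ge> 1" "t > 0" for k t
    using that \<open>j \<ge> 1\<close>
    by (intro transition_function_backward_left[OF p] jump out cont_p) auto
  have init: "p 0 k j = yule_transition l 0 k j" if "k \<ge> 1" for k
    using that \<open>j \<ge> 1\<close> p by (simp add: yule_transition_0 transition_function_def)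
  have b: "\<bar>p t k j - yule_transition l t k j\<bar> \<le> 1 + 2 ^ (j - 1)" if "k \<ge> 1" "t \<ge> 0" for k t
    using transition_function_bounds[OF p, of t k j] that \<open>j \<ge> 1\<close>
      yule_transition_bounded[OF \<open>l > 0\<close>, of t k j] by auto
  have "p t i j - yule_transition l t i j \<le> 0"
  proof (rule birth_backward_maximum_principle[where v = "\<lambda>k t. p t k j - yule_transition l t k j"])
    fix k :: nat and t :: real assume k: "k \<ge> 1"
    show "continuous_on {0..} (\<lambda>t. p t k j - yule_transition l t k j)"
      by (intro continuous_intros cont_p cont_y k)
    show "p 0 k j - yule_transition l 0 k j \<le> 0"
      using init[OF k] by simp
    show "p t k j - yule_transition l t k j \<le> 1 + 2 ^ (j - 1)" if "t \<ge> 0"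
      using b[OF k that] by linarith
    show "((\<lambda>t. p t k j - yule_transition l t k j) has_real_derivative (real k * l) *
      ((p t (Suc k) j - yule_transition l t (Suc k) j) - (p t k j - yule_transition l t k j))) (at_left t)"
      if "t > 0"
      by (rule DERIV_cong[OF DERIV_diff[OF deriv_p[OF k that] yule_transition_backward[OF k \<open>j \<ge> 1\<close>]]])
        (simp add: algebra_simps)
  qed fact+
  moreover have "yule_transition l t i j - p t i j \<le> 0"
  proof (rule birth_backward_maximum_principle[where v = "\<lambda>k t. yule_transition l t k j - p t k j"])
    fix k :: nat and t :: real assume k: "k \<ge> 1"
    show "continuous_on {0..} (\<lambda>t. yule_transition l t k j - p t k j)"
      by (intro continuous_intros cont_p cont_y k)
    show "yule_transition l 0 k j - p 0 k j \<le> 0"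
      using init[OF k] by simp
    show "yule_transition l t k j - p t k j \<le> 1 + 2 ^ (j - 1)" if "t \<ge> 0"
      using b[OF k that] by linarith
    show "((\<lambda>t. yule_transition l t k j - p t k j) has_real_derivative (real k * l) *
      ((yule_transition l t (Suc k) j - p t (Suc k) j) - (yule_transition l t k j - p t k j))) (at_left t)"
      if "t > 0"
      by (rule DERIV_cong[OF DERIV_diff[OF yule_transition_backward[OF k \<open>j \<ge> 1\<close>] deriv_p[OF k that]]])
        (simp add: algebra_simps)
  qed fact+
  ultimately show ?thesis
    by simp
qed

section \<open>The one-dimensional law of the process\<close>

lemma sets_Collect_eq_count_space:
  assumes "N \<in> measurable M (count_space A)"
  shows "{\<omega> \<in> space M. N \<omega> = n} \<in> sets M"
proof -
  have "{\<omega> \<in> space M. N \<omega> = n} = N -` ({n} \<inter> A) \<inter> space M"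
    using measurable_space[OF assms] by auto
  then show ?thesis
    using measurable_sets[OF assms, of "{n} \<inter> A"] by simp
qed

lemma linear_birth_process_marginal:
  assumes "prob_space M" and B: "linear_birth_process M l B" and "l > 0" "t \<ge> 0" "n \<ge> 1"
  shows "measure M {\<omega> \<in> space M. B t \<omega> = n} = exp (- l * t) * (1 - exp (- l * t)) ^ (n - 1)"
proof -
  interpret prob_space M by fact
  obtain p where p: "markov_chain M {1..} p B"
    and jump: "\<And>k. k \<ge> 1 \<Longrightarrow> ((\<lambda>h. p h k (Suc k) / h) \<longlongrightarrow> real k * l) (at_right 0)"
    and out: "\<And>k. k \<ge> 1 \<Longrightarrow> ((\<lambda>h. (1 - p h k k) / h) \<longlongrightarrow> real k * l) (at_right 0)"
    and B0: "AE \<omega> in M. B 0 \<omega> = 1"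
    using B by (auto simp: linear_birth_process_def)
  have tf: "transition_function {1..} p"
    and meas: "\<And>t. t \<ge> 0 \<Longrightarrow> B t \<in> measurable M (count_space {1..})"
    using p by (auto simp: markov_chain_def)
  have ev: "{\<omega> \<in> space M. B t \<omega> = k} \<in> events" if "t \<ge> 0" for t k
    by (rule sets_Collect_eq_count_space[OF meas[OF that]])
  have "prob {\<omega> \<in> space M. B t \<omega> = n} = yule_transition l t 1 n"
  \<comment> \<open>The Markov property speaks only of strictly later times, so time 0 is settled
    from the initial condition.\<close>
  proof (cases "t = 0")
    case True
    have "prob {\<omega> \<in> space M. B 0 \<omega> = n} = prob {\<omega> \<in> space M. 1 = n}"
      using B0 ev[of 0 n] by (intro prob_eq_AE) auto
    then show ?thesis
      using True \<open>n \<ge> 1\<close> by (auto simp: yule_transition_0 prob_space)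
  next
    case False
    have p1: "prob {\<omega> \<in> space M. B 0 \<omega> = 1} = 1"
      using B0 ev[of 0 1] by (simp add: prob_Collect_eq_1)
    \<comment> \<open>The Markov property for the single observation time 0 and the observed state
      1; the conditioning event has probability 1, so the guard holds.\<close>
    have "\<P>(\<omega> in M. B t \<omega> = n \<bar> B 0 \<omega> = 1) = p t 1 n"
      using p False \<open>t \<ge> 0\<close> \<open>n \<ge> 1\<close> p1 unfolding markov_chain_def
      by (elim conjE allE[where x = "0::nat"] allE[where x = "\<lambda>_::nat. 0::real"]
          allE[where x = "\<lambda>_::nat. 1::nat"] allE[where x = t]) auto
    then have "prob {\<omega> \<in> space M. B t \<omega> = n \<and> B 0 \<omega> = 1} = p t 1 n"
      using p1 by (simp add: cond_prob_def)
    moreover have "prob {\<omega> \<in> space M. B t \<omega> = n \<and> B 0 \<omega> = 1} = prob {\<omega> \<in> space M. B t \<omega> = n}"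
      using B0 ev[of 0 1] ev[OF \<open>t \<ge> 0\<close>, of n] by (intro prob_eq_AE) (auto intro: sets.sets_Collect_conj)
    ultimately show ?thesis
      using linear_birth_transition[OF tf \<open>l > 0\<close> jump out, of 1 n t] assms by simp
  qed
  then show ?thesis
    by (simp add: yule_transition_def)
qed

section \<open>Random sums as mixtures of Erlang laws\<close>

text \<open>Index \<open>n\<close> stands for \<open>n + 1\<close> summands, since
  \<open>erlang_density n\<close> has shape \<open>n + 1\<close>. The factorial in the Erlang
  density makes this an exponential series, and the exponents combine to
  \<open>- \<xi> * x * y\<close>.\<close>

lemma geometric_erlang_mixture:
  "(\<lambda>n. x * (1 - x) ^ n * erlang_density n \<xi> y) sums (\<xi> * x * exp (- \<xi> * x * y) * indicator {0..} y)"
proof (cases "y < 0")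
  case False
  have "(\<lambda>n. \<xi> * x * exp (- \<xi> * y) * (((1 - x) * \<xi> * y) ^ n /\<^sub>R fact n))
      sums (\<xi> * x * exp (- \<xi> * y) * exp ((1 - x) * \<xi> * y))"
    by (intro sums_mult exp_converges)
  moreover have "\<xi> * x * exp (- \<xi> * y) * exp ((1 - x) * \<xi> * y) = \<xi> * x * exp (- \<xi> * x * y) * indicator {0..} y"
    using False by (simp add: algebra_simps flip: exp_add)
  moreover have "\<xi> * x * exp (- \<xi> * y) * (((1 - x) * \<xi> * y) ^ n /\<^sub>R fact n)
      = x * (1 - x) ^ n * erlang_density n \<xi> y" for n
    using False by (simp add: erlang_density_def power_mult_distrib divide_inverse)
  ultimately show ?thesis
    by (simp only:)
qed (simp add: erlang_density_def)

text \<open>Splitting an event according to the value of \<open>N\<close> gives countably many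
  disjoint pieces; independence factors each one, and monotone convergence exchanges sum and
  integral.\<close>

lemma (in prob_space) distributed_mixture:
  fixes N :: "'a \<Rightarrow> nat" and Z :: "nat \<Rightarrow> 'a \<Rightarrow> 'b"
  assumes N: "N \<in> measurable M (count_space {1..})"
    and Z: "\<And>n. n \<ge> 1 \<Longrightarrow> distributed M L (Z n) (f n)"
    and indep: "\<And>n A. n \<ge> 1 \<Longrightarrow> A \<in> sets L \<Longrightarrow>
      prob {\<omega> \<in> space M. N \<omega> = n \<and> Z n \<omega> \<in> A} =
      prob {\<omega> \<in> space M. N \<omega> = n} * prob {\<omega> \<in> space M. Z n \<omega> \<in> A}"
  shows "distributed M L (\<lambda>\<omega>. Z (N \<omega>) \<omega>)
    (\<lambda>y. \<Sum>n. ennreal (prob {\<omega> \<in> space M. N \<omega> = Suc n}) * f (Suc n) y)"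
proof -
  have Zm: "Z n \<in> measurable M L" if "n \<ge> 1" for n
    using Z[OF that] by (auto simp: distributed_def)
  have fm[measurable]: "f (Suc n) \<in> borel_measurable L" for n
    using Z[of "Suc n"] by (auto simp: distributed_def)
  have Y: "(\<lambda>\<omega>. Z (N \<omega>) \<omega>) \<in> measurable M L"
    by (rule measurable_compose_countable'[OF Zm N]) auto
  have Nev: "{\<omega> \<in> space M. N \<omega> = n} \<in> events" for n
    by (rule sets_Collect_eq_count_space[OF N])
  let ?g = "\<lambda>y. \<Sum>n. ennreal (prob {\<omega> \<in> space M. N \<omega> = Suc n}) * f (Suc n) y"
  have gm: "?g \<in> borel_measurable L"
    by measurable
  have "emeasure (distr M L (\<lambda>\<omega>. Z (N \<omega>) \<omega>)) A = emeasure (density L ?g) A" if A: "A \<in> sets L" for A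
  proof -
    let ?E = "\<lambda>n. {\<omega> \<in> space M. N \<omega> = Suc n \<and> Z (Suc n) \<omega> \<in> A}"
    have ZA: "{\<omega> \<in> space M. Z (Suc n) \<omega> \<in> A} \<in> events" for n
      using Zm[of "Suc n"] A by (auto dest: measurable_sets simp: vimage_def Int_def conj_commute)
    have Eev: "?E n \<in> events" for n
      by (rule sets.sets_Collect_conj[OF ZA Nev])
    have piece: "emeasure M (?E n) = (\<integral>\<^sup>+y. ennreal (prob {\<omega> \<in> space M. N \<omega> = Suc n}) * f (Suc n) y * indicator A y \<partial>L)" for n
    proof -
      have "emeasure M (?E n) = ennreal (prob {\<omega> \<in> space M. N \<omega> = Suc n}) * emeasure M {\<omega> \<in> space M. Z (Suc n) \<omega> \<in> A}"
        using indep[of "Suc n" A] A by (simp add: emeasure_eq_measure ennreal_mult)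
      also have "{\<omega> \<in> space M. Z (Suc n) \<omega> \<in> A} = Z (Suc n) -` A \<inter> space M"
        by auto
      also have "emeasure M \<dots> = (\<integral>\<^sup>+y. f (Suc n) y * indicator A y \<partial>L)"
        using Z[of "Suc n"] A by (intro distributed_emeasure) auto
      finally show ?thesis
        using A fm[of n] by (simp add: nn_integral_cmult mult.assoc)
    qed
    \<comment> \<open>As \<open>N\<close> is never 0, the pieces indexed by \<open>Suc n\<close>
      cover the whole event.\<close>
    have "N \<omega> \<ge> 1" if "\<omega> \<in> space M" for \<omega>
      using measurable_space[OF N that] by simp
    then have "(\<lambda>\<omega>. Z (N \<omega>) \<omega>) -` A \<inter> space M = (\<Union>n. ?E n)"
      by auto (metis One_nat_def Suc_le_D)
    then have "emeasure (distr M L (\<lambda>\<omega>. Z (N \<omega>) \<omega>)) A = emeasure M (\<Union>n. ?E n)"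
      using A Y by (simp add: emeasure_distr)
    also have "\<dots> = (\<Sum>n. emeasure M (?E n))"
      using Eev by (intro suminf_emeasure[symmetric]) (auto simp: disjoint_family_on_def)
    also have "\<dots> = (\<integral>\<^sup>+y. (\<Sum>n. ennreal (prob {\<omega> \<in> space M. N \<omega> = Suc n}) * f (Suc n) y * indicator A y) \<partial>L)"
      unfolding piece using A by (intro nn_integral_suminf[symmetric] borel_measurable_times_ennreal
          borel_measurable_const borel_measurable_indicator fm)
    also have "\<dots> = emeasure (density L ?g) A"
      using A gm by (simp add: emeasure_density)
    finally show ?thesis .
  qed
  then have "distr M L (\<lambda>\<omega>. Z (N \<omega>) \<omega>) = density L ?g"
    by (intro measure_eqI) auto
  then show ?thesis
    using Y gm by (simp add: distributed_def)
qed

lemma indep_elements_prob: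
  assumes "prob_space M" and ind: "indep_elements M N U N' V"
    and S: "S \<in> sets N" "T \<in> sets N'"
  shows "measure M {\<omega> \<in> space M. U \<omega> \<in> S \<and> V \<omega> \<in> T} =
    measure M {\<omega> \<in> space M. U \<omega> \<in> S} * measure M {\<omega> \<in> space M. V \<omega> \<in> T}"
proof -
  interpret prob_space M by fact
  have "prob ((U -` S \<inter> space M) \<inter> (V -` T \<inter> space M)) = prob (U -` S \<inter> space M) * prob (V -` T \<inter> space M)"
    using ind S by (intro indep_setD) (auto simp: indep_elements_def)
  moreover have "(U -` S \<inter> space M) \<inter> (V -` T \<inter> space M) = {\<omega> \<in> space M. U \<omega> \<in> S \<and> V \<omega> \<in> T}"
    "U -` S \<inter> space M = {\<omega> \<in> space M. U \<omega> \<in> S}" "V -` T \<inter> space M = {\<omega> \<in> space M. V \<omega> \<in> T}"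
    by auto
  ultimately show ?thesis by simp
qed

text \<open>The mixture lemma with \<open>N\<close> as \<open>B t\<close> and \<open>Z n\<close> as
  the sum of the first \<open>n\<close> variables. Its independence hypothesis follows from that of
  the whole path and the whole sequence, through sets depending on finitely many
  coordinates.\<close>

lemma distributed_yule_exponential_sum:
  fixes X :: "nat \<Rightarrow> 'a \<Rightarrow> real"
  assumes "prob_space M" and "l > 0" and "\<xi> > 0"
    and B: "linear_birth_process M l B"
    and ind: "prob_space.indep_vars M (\<lambda>_. borel) X {1..}"
    and X: "\<And>j. j \<ge> 1 \<Longrightarrow> distributed M lborel (X j) (\<lambda>x. ennreal (exponential_density \<xi> x))"
    and BX: "indep_elements M
           (Pi\<^sub>M {0..} (\<lambda>_. count_space {1..})) (\<lambda>\<omega>. \<lambda>t\<in>{0..}. B t \<omega>)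
           (Pi\<^sub>M {1..} (\<lambda>_. borel)) (\<lambda>\<omega>. \<lambda>j\<in>{1..}. X j \<omega>)"
    and "t \<ge> 0"
  shows "distributed M lborel (\<lambda>\<omega>. \<Sum>j=1..B t \<omega>. X j \<omega>) (\<lambda>y. ennreal (f_Y l \<xi> y t * indicator {0..} y))"
proof -
  interpret prob_space M by fact
  define x where "x = exp (- l * t)"
  have x: "0 < x" "x \<le> 1"
    using \<open>l > 0\<close> \<open>t \<ge> 0\<close> by (auto simp: x_def)
  have "distributed M lborel (\<lambda>\<omega>. \<Sum>j=1..B t \<omega>. X j \<omega>)
    (\<lambda>y. \<Sum>n. ennreal (prob {\<omega> \<in> space M. B t \<omega> = Suc n}) * ennreal (erlang_density (Suc n - 1) \<xi> y))"
  proof (rule distributed_mixture)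
    show "B t \<in> measurable M (count_space {1..})"
      using B \<open>t \<ge> 0\<close> by (auto simp: linear_birth_process_def markov_chain_def)
    fix n :: nat assume n: "n \<ge> 1"
    show "distributed M lborel (\<lambda>\<omega>. \<Sum>j=1..n. X j \<omega>) (\<lambda>y. ennreal (erlang_density (n - 1) \<xi> y))"
      using exponential_distributed_sum[of "{1..n}" \<xi> X] n \<open>\<xi> > 0\<close> X indep_vars_subset[OF ind]
      by auto
    fix A :: "real set" assume A: "A \<in> sets lborel"
    let ?N = "Pi\<^sub>M {0..} (\<lambda>_. count_space {1..}) :: (real \<Rightarrow> nat) measure"
    let ?N' = "Pi\<^sub>M {1..} (\<lambda>_. borel) :: (nat \<Rightarrow> real) measure"
    have S: "{b \<in> space ?N. b t = n} \<in> sets ?N"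
    proof -
      have "(\<lambda>b. b t) -` {n} \<inter> space ?N \<in> sets ?N"
        using n \<open>t \<ge> 0\<close> by (intro measurable_sets[OF measurable_component_singleton]) auto
      then show ?thesis by (simp add: vimage_def Int_def conj_commute)
    qed
    have T: "{u \<in> space ?N'. (\<Sum>j=1..n. u j) \<in> A} \<in> sets ?N'"
    proof -
      have "(\<lambda>u. \<Sum>j=1..n. u j) -` A \<inter> space ?N' \<in> sets ?N'"
        using A by (intro measurable_sets[of _ _ borel] borel_measurable_sum measurable_component_singleton) auto
      then show ?thesis by (simp add: vimage_def Int_def conj_commute)
    qed
    \<comment> \<open>Membership in the product spaces reduces the cylinder events to conditions on
      \<open>B t\<close> and on the partial sum.\<close>
    have U: "(\<lambda>t\<in>{0..}. B t \<omega>) \<in> space ?N" "(\<lambda>j\<in>{1..}. X j \<omega>) \<in> space ?N'" if "\<omega> \<in> space M" for \<omega>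
      using BX that by (auto simp: indep_elements_def dest: measurable_space)
    have *: "(\<Sum>j=1..n. (\<lambda>j\<in>{1..}. X j \<omega>) j) = (\<Sum>j=1..n. X j \<omega>)" for \<omega>
      by (intro sum.cong) auto
    show "prob {\<omega> \<in> space M. B t \<omega> = n \<and> (\<Sum>j=1..n. X j \<omega>) \<in> A} =
      prob {\<omega> \<in> space M. B t \<omega> = n} * prob {\<omega> \<in> space M. (\<Sum>j=1..n. X j \<omega>) \<in> A}"
      using indep_elements_prob[OF \<open>prob_space M\<close> BX S T] U \<open>t \<ge> 0\<close>
      unfolding mem_Collect_eq * by (simp cong: conj_cong)
  qed
  moreover have "(\<Sum>n. ennreal (prob {\<omega> \<in> space M. B t \<omega> = Suc n}) * ennreal (erlang_density (Suc n - 1) \<xi> y))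
      = ennreal (f_Y l \<xi> y t * indicator {0..} y)" for y
  proof -
    have "f_Y l \<xi> y t = \<xi> * x * exp (- \<xi> * x * y)"
      by (simp add: f_Y_def x_def exp_diff exp_minus divide_inverse)
    moreover have "(\<Sum>n. ennreal (x * (1 - x) ^ n * erlang_density n \<xi> y))
        = ennreal (\<xi> * x * exp (- \<xi> * x * y) * indicator {0..} y)"
      using x \<open>\<xi> > 0\<close> by (intro suminf_ennreal_eq geometric_erlang_mixture) auto
    ultimately show ?thesis
      using x \<open>\<xi> > 0\<close>
        linear_birth_process_marginal[OF \<open>prob_space M\<close> B \<open>l > 0\<close> \<open>t \<ge> 0\<close>, folded x_def, of "Suc _"]
      by (simp flip: ennreal_mult)
  qed
  ultimately show ?thesis
    by simp
qed

section \<open>The transport equation\<close>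

text \<open>Both derivatives are multiples of \<open>f_Y\<close> with the common factor
  \<open>?c\<close>. Arbitrary sets \<open>S\<close> and \<open>T\<close> cover the one-sided
  derivatives at the boundary.\<close>

lemma f_Y_transport:
  "\<exists>D\<^sub>t D\<^sub>y. ((\<lambda>s. f_Y l \<xi> y s) has_real_derivative D\<^sub>t) (at t within S) \<and>
    ((\<lambda>z. z * f_Y l \<xi> z t) has_real_derivative D\<^sub>y) (at y within T) \<and> D\<^sub>t = - l * D\<^sub>y"
proof (intro exI conjI)
  let ?c = "1 - \<xi> * exp (- l * t) * y"
  show "((\<lambda>s. f_Y l \<xi> y s) has_real_derivative - l * (?c * f_Y l \<xi> y t)) (at t within S)"
    unfolding f_Y_def by (rule derivative_eq_intros refl)+ (simp add: algebra_simps)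
  show "((\<lambda>z. z * f_Y l \<xi> z t) has_real_derivative ?c * f_Y l \<xi> y t) (at y within T)"
    unfolding f_Y_def by (rule derivative_eq_intros refl)+ (simp add: algebra_simps)
qed simp

theorem lemma2p1:
  fixes M :: "'a measure"
    and l \<xi> :: real
    and B :: "real \<Rightarrow> 'a \<Rightarrow> nat"
    and X :: "nat \<Rightarrow> 'a \<Rightarrow> real"
  assumes "prob_space M"
    and "l > 0" and "\<xi> > 0"
    and "linear_birth_process M l B"
    and "prob_space.indep_vars M (\<lambda>_. borel) X {1..}"
    and "\<And>j. j \<ge> 1 \<Longrightarrow> distributed M lborel (X j) (\<lambda>x. ennreal (exponential_density \<xi> x))"
    and "indep_elements M
           (Pi\<^sub>M {0..} (\<lambda>_. count_space {1..})) (\<lambda>\<omega>. \<lambda>t\<in>{0..}. B t \<omega>)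
           (Pi\<^sub>M {1..} (\<lambda>_. borel)) (\<lambda>\<omega>. \<lambda>j\<in>{1..}. X j \<omega>)"
  shows "(\<forall>t\<ge>0. distributed M lborel (\<lambda>\<omega>. \<Sum>j=1..B t \<omega>. X j \<omega>)
            (\<lambda>y. ennreal (f_Y l \<xi> y t * indicator {0..} y))) \<and>
         (\<forall>y\<ge>0. \<forall>t\<ge>0. \<exists>D\<^sub>t D\<^sub>y.
            ((\<lambda>s. f_Y l \<xi> y s) has_real_derivative D\<^sub>t) (at t within {0..}) \<and>
            ((\<lambda>z. z * f_Y l \<xi> z t) has_real_derivative D\<^sub>y) (at y within {0..}) \<and>
            D\<^sub>t = - l * D\<^sub>y) \<and>
         (\<forall>y\<ge>0. f_Y l \<xi> y 0 = exponential_density \<xi> y \<and>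
                exponential_density \<xi> y = \<xi> * exp (- \<xi> * y))"
  using distributed_yule_exponential_sum[OF assms] f_Y_transport
  by (auto simp: f_Y_def exponential_density_def)

end
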